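(* Let $H$ be a complex Hilbert space and let $A$, with domain $D(A)$, be the generator of a $C_0$-semigroup $(e^{tA})_{t\ge 0}$ on $H$. The following are equivalent: (i) $A$ is bounded. (ii) The semigroup $e^{tA}$ is quasi-contractive with respect to every equivalent scalar product $(\cdot,\cdot)_0$ on $H$. (iii) For every equivalent scalar product $(\cdot,\cdot)_0$ on $H$ there exists $K_0\in\mathbb{R}$ such that for every vector $x\in D(A)$, $(x,x)_0=1$ implies $\mathrm{Re}\,(Ax,x)_0\le K_0$.
   Context: Scalar products are linear in the first argument. A scalar product $(\cdot,\cdot)_0$ on the vector space $H$ is called equivalent if its induced norm $\|x\|_0=(x,x)_0^{1/2}$ is equivalent to the original norm of $H$. The semigroup $e^{tA}$ is quasi-contractive with respect to $(\cdot,\cdot)_0$ if there exists $\omega\in\mathbb{R}$ such that $\|e^{tA}x\|_0\le e^{\omega t}\|x\|_0$ for all $t\ge 0$ and all $x\in H$. "$A$ is bounded" means that $A$ is a bounded linear operator defined on all of $H$, i.e. $A\in\mathcal{L}(H)$, where $\mathcal{L}(H)$ denotes the bounded linear operators on $H$. *)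

theory Defs
  imports "HOL-Analysis.Analysis"
begin

class complex_vector = real_vector +
  fixes scaleC :: "complex \<Rightarrow> 'a \<Rightarrow> 'a"  (infixr "*\<^sub>C" 75)
  assumes scaleC_add_right: "a *\<^sub>C (x + y) = a *\<^sub>C x + a *\<^sub>C y"
    and scaleC_add_left: "(a + b) *\<^sub>C x = a *\<^sub>C x + b *\<^sub>C x"
    and scaleC_scaleC: "a *\<^sub>C (b *\<^sub>C x) = (a * b) *\<^sub>C x"
    and scaleC_one: "1 *\<^sub>C x = x"
    and scaleR_scaleC: "r *\<^sub>R x = complex_of_real r *\<^sub>C x"

locale scalar_product =
  fixes g :: "'a::complex_vector \<Rightarrow> 'a \<Rightarrow> complex"
  assumes add_left: "g (x + y) z = g x z + g y z"
    and scaleC_left: "g (c *\<^sub>C x) z = c * g x z"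
    and commute: "g y x = cnj (g x y)"
    and pos_def: "x \<noteq> 0 \<Longrightarrow> 0 < Re (g x x)"

text \<open>By \<open>commute\<close>, the number \<open>g x x\<close> is real, so taking real parts loses nothing.\<close>

definition norm_of :: "('a \<Rightarrow> 'a \<Rightarrow> complex) \<Rightarrow> 'a \<Rightarrow> real"
  where "norm_of g x = sqrt (Re (g x x))"

class complex_hilbert_space = complex_vector + banach +
  fixes cinner :: "'a \<Rightarrow> 'a \<Rightarrow> complex"
  assumes cinner_add_left: "cinner (x + y) z = cinner x z + cinner y z"
    and cinner_scaleC_left: "cinner (c *\<^sub>C x) z = c * cinner x z"
    and cinner_commute: "cinner y x = cnj (cinner x y)"
    and cinner_pos_def: "x \<noteq> 0 \<Longrightarrow> 0 < Re (cinner x x)"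
    and norm_eq_sqrt_cinner: "norm x = sqrt (Re (cinner x x))"

lemma scalar_product_cinner:
  "scalar_product (cinner :: 'a::complex_hilbert_space \<Rightarrow> 'a \<Rightarrow> complex)"
  using cinner_add_left cinner_scaleC_left cinner_commute cinner_pos_def
  by (rule scalar_product.intro)

definition equivalent_scalar_product ::
    "('a::complex_hilbert_space \<Rightarrow> 'a \<Rightarrow> complex) \<Rightarrow> bool"
  where "equivalent_scalar_product g \<longleftrightarrow>
    scalar_product g \<and>
    (\<exists>c>0. \<exists>C>0. \<forall>x. c * norm x \<le> norm_of g x \<and> norm_of g x \<le> C * norm x)"

definition bounded_clinear :: "('a::complex_hilbert_space \<Rightarrow> 'a) \<Rightarrow> bool"
  where "bounded_clinear f \<longleftrightarrow>
    Vector_Spaces.linear scaleC scaleC f \<and> (\<exists>K. \<forall>x. norm (f x) \<le> K * norm x)"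

text \<open>Only the values \<open>T t\<close> with \<open>t \<ge> 0\<close> are constrained; those at negative \<open>t\<close> are irrelevant.\<close>

locale C0_semigroup =
  fixes T :: "real \<Rightarrow> 'a::complex_hilbert_space \<Rightarrow> 'a"
  assumes bounded_clinear: "0 \<le> t \<Longrightarrow> bounded_clinear (T t)"
    and zero: "T 0 x = x"
    and add: "0 \<le> s \<Longrightarrow> 0 \<le> t \<Longrightarrow> T (s + t) x = T s (T t x)"
    and strongly_continuous: "((\<lambda>t. T t x) \<longlongrightarrow> x) (at_right 0)"

text \<open>An operator with domain \<open>D\<close> is represented by a total function \<open>A\<close> whose values outside
  \<open>D\<close> are arbitrary.\<close>

definition generator ::
    "(real \<Rightarrow> 'a::complex_hilbert_space \<Rightarrow> 'a) \<Rightarrow> 'a set \<Rightarrow> ('a \<Rightarrow> 'a) \<Rightarrow> bool"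
  where "generator T D A \<longleftrightarrow>
    D = {x. \<exists>y. ((\<lambda>h. (T h x - x) /\<^sub>R h) \<longlongrightarrow> y) (at_right 0)} \<and>
    (\<forall>x\<in>D. ((\<lambda>h. (T h x - x) /\<^sub>R h) \<longlongrightarrow> A x) (at_right 0))"

definition bounded_operator :: "'a::complex_hilbert_space set \<Rightarrow> ('a \<Rightarrow> 'a) \<Rightarrow> bool"
  where "bounded_operator D A \<longleftrightarrow> D = UNIV \<and> bounded_clinear A"

definition quasi_contractive ::
    "('a::complex_hilbert_space \<Rightarrow> 'a \<Rightarrow> complex) \<Rightarrow> (real \<Rightarrow> 'a \<Rightarrow> 'a) \<Rightarrow> bool"
  where "quasi_contractive g T \<longleftrightarrow>
    (\<exists>\<omega>::real. \<forall>t\<ge>0. \<forall>x. norm_of g (T t x) \<le> exp (\<omega> * t) * norm_of g x)"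

end

theory Submission
  imports Defs
begin

text \<open>
  The substantial implication is (iii) to (i). Apply (iii) to the rank-one perturbations
  \<open>(x, y) + (x, u)(u, y)\<close> of the original scalar product and let
  \<open>p x = (\<bar>K\<bar> + 1) \<parallel>x\<parallel>\<^sup>2 - Re (A x, x)\<close>, which dominates \<open>\<parallel>x\<parallel>\<^sup>2\<close>. Adding to
  \<open>y \<in> D\<close> a multiple of a fixed \<open>x0\<close> with \<open>(u, x0) = 1\<close> gives \<open>\<bar>(A y, u)\<bar> \<le> C u\<close> for all \<open>y\<close> with
  \<open>p y \<le> 1\<close>, so by uniform boundedness \<open>\<parallel>A y\<parallel>\<^sup>2 \<le> C\<^sup>2 p y\<close>. As \<open>p y\<close> is only linear in \<open>\<parallel>A y\<parallel>\<close>,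
  \<open>A\<close> is bounded on \<open>D\<close>. Finally \<open>D\<close> is the whole space: the difference quotient
  \<open>(T t x - x) / t\<close> is \<open>A\<close> applied to the mean of the orbit over \<open>[0, t]\<close>, and these means converge
  to \<open>x\<close>.
\<close>

section \<open>The uniform boundedness principle\<close>

text \<open>By Baire, one of the closed sets \<open>S n\<close>, which cover the space, contains a
  ball; linearity carries the bound on this ball over to the origin. The general index set and
  codomain serve two uses: the operators \<open>T (s n)\<close> near time 0 and the functionals
  \<open>cinner u (A y)\<close> indexed by \<open>y\<close>.\<close>

lemma uniform_boundedness:
  fixes f :: "'i \<Rightarrow> 'a::banach \<Rightarrow> 'b::real_normed_vector"
  assumes bl: "\<And>i. i \<in> I \<Longrightarrow> bounded_linear (f i)"
    and pointwise: "\<And>x. \<exists>C. \<forall>i\<in>I. norm (f i x) \<le> C"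
  obtains C where "0 \<le> C" "\<And>i x. i \<in> I \<Longrightarrow> norm (f i x) \<le> C * norm x"
proof -
  define S where "S n = {x. \<forall>i\<in>I. norm (f i x) \<le> real n}" for n
  have closed: "closed (S n)" for n
  proof -
    have "S n = (\<Inter>i\<in>I. {x. norm (f i x) \<le> real n})"
      by (auto simp: S_def)
    moreover have "closed {x. norm (f i x) \<le> real n}" if "i \<in> I" for i
      by (intro closed_Collect_le continuous_intros linear_continuous_on bl that)
    ultimately show ?thesis by auto
  qed
  have "(\<Union>n. S n) = UNIV"
  proof -
    have "\<exists>n. x \<in> S n" for x
    proof -
      obtain C where C: "\<forall>i\<in>I. norm (f i x) \<le> C" using pointwise by blast
      obtain n where "C \<le> real n" using real_arch_simple by blast
      with C have "x \<in> S n" by (force simp: S_def)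
      then show ?thesis ..
    qed
    then show ?thesis by auto
  qed
  have "\<exists>n. interior (S n) \<noteq> {}"
  proof (rule ccontr)
    assume "\<not> ?thesis"
    then have "euclidean interior_of \<Union>(range S) = {}"
      using closed completely_metrizable_space_euclidean by (intro Baire_category_alt) auto
    with \<open>(\<Union>n. S n) = UNIV\<close> show False by simp
  qed
  then obtain n a where "a \<in> interior (S n)" by auto
  then obtain r where r: "r > 0" "cball a r \<subseteq> S n" by (auto simp: mem_interior_cball)
  show ?thesis
  proof (rule that[of "2 * real n / r"])
    show "0 \<le> 2 * real n / r" using r by simp
  next
    fix i x assume i: "i \<in> I"
    interpret bounded_linear "f i" by (rule bl[OF i])
    show "norm (f i x) \<le> 2 * real n / r * norm x"
    proof (cases "x = 0")
      case False
      \<comment> \<open>Rescaling \<open>x\<close> to length \<open>r\<close> keeps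
        \<open>a + y\<close> in the ball. The factor 2 in the constant arises because
        \<open>f i y\<close> is a difference of two values of norm at most \<open>n\<close>.\<close>
      define y where "y = (r / norm x) *\<^sub>R x"
      have "norm y = r" using False r by (simp add: y_def)
      then have "a + y \<in> S n" "a \<in> S n" using r by (auto intro!: subsetD[OF r(2)] simp: dist_norm)
      then have "norm (f i (a + y)) \<le> n" "norm (f i a) \<le> n" using i by (auto simp: S_def)
      moreover have "f i y = f i (a + y) - f i a" by (simp add: add)
      ultimately have "norm (f i y) \<le> 2 * real n"
        using norm_triangle_ineq4[of "f i (a + y)" "f i a"] by simp
      moreover have "norm (f i y) = r / norm x * norm (f i x)"
        using r by (simp add: y_def scaleR)
      ultimately show ?thesis using False r by (simp add: field_simps)
    qed (simp add: zero)
  qed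
qed

section \<open>Complex scalars and scalar products\<close>

lemma scaleC_minus_one: "(-1) *\<^sub>C x = - (x :: 'a::complex_vector)"
  using scaleR_scaleC[of "-1" x] by simp

lemma scaleC_diff_right: "c *\<^sub>C (x - y) = c *\<^sub>C x - c *\<^sub>C (y :: 'a::complex_vector)"
  using scaleC_add_right[of c "x - y" y] by (simp add: eq_diff_eq)

lemma scaleC_zero_left [simp]: "0 *\<^sub>C (x :: 'a::complex_vector) = 0"
  using scaleR_scaleC[of 0 x] by simp

lemma scaleC_scaleR: "c *\<^sub>C (r *\<^sub>R x) = r *\<^sub>R (c *\<^sub>C (x :: 'a::complex_vector))"
  by (simp add: scaleR_scaleC scaleC_scaleC mult.commute)

context scalar_product
begin

lemma add_right: "g x (y + z) = g x y + g x z"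
  using commute[of x "y + z"] commute[of x y] commute[of x z] by (simp add: add_left)

lemma scaleC_right: "g x (c *\<^sub>C y) = cnj c * g x y"
  using commute[of x "c *\<^sub>C y"] commute[of x y] by (simp add: scaleC_left)

lemma scaleR_left: "g (r *\<^sub>R x) y = r *\<^sub>R g x y"
  by (simp add: scaleR_scaleC[of r x] scaleC_left scaleR_conv_of_real)

lemma scaleR_right: "g x (r *\<^sub>R y) = r *\<^sub>R g x y"
  by (simp add: scaleR_scaleC[of r y] scaleC_right scaleR_conv_of_real)

lemma diff_left: "g (x - y) z = g x z - g y z"
  using add_left[of "x - y" y z] by simp

lemma diff_right: "g x (y - z) = g x y - g x z"
  using add_right[of x "y - z" z] by simp

lemma zero_left [simp]: "g 0 x = 0"
  using diff_left[of 0 0 x] by simp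

lemma zero_right [simp]: "g x 0 = 0"
  using diff_right[of x 0 0] by simp

lemma nonneg: "0 \<le> Re (g x x)"
  using pos_def[of x] by (cases "x = 0") auto

lemma self_real: "g x x = complex_of_real (Re (g x x))"
  using commute[of x x] by (simp add: complex_eq_iff)

lemma norm_of_square: "(norm_of g x)\<^sup>2 = Re (g x x)"
  by (simp add: norm_of_def nonneg)

lemma norm_of_nonneg: "0 \<le> norm_of g x"
  by (simp add: norm_of_def nonneg)

lemma Cauchy_Schwarz: "norm (g x y) \<le> norm_of g x * norm_of g y"
proof (cases "y = 0")
  case False
  define b where "b = Re (g y y)"
  have b: "g y y = of_real b" "b > 0" using self_real[of y] pos_def[OF False] by (auto simp: b_def)
  \<comment> \<open>This is \<open>b\<close> times the component of \<open>x\<close> orthogonal to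
    \<open>y\<close>; the factor \<open>b\<close> avoids a division.\<close>
  define z where "z = of_real b *\<^sub>C x - g x y *\<^sub>C y"
  have "g z z = of_real b * (of_real b * g x x - g x y * cnj (g x y))"
    unfolding z_def diff_left diff_right scaleC_left scaleC_right b(1) commute[of y x]
    by (simp add: algebra_simps)
  then have "Re (g z z) = b * (b * Re (g x x) - (norm (g x y))\<^sup>2)"
    by (simp add: complex_norm_square[symmetric] del: of_real_power)
  then have "0 \<le> b * (b * Re (g x x) - (norm (g x y))\<^sup>2)"
    using nonneg[of z] by simp
  then have "(norm (g x y))\<^sup>2 \<le> b * Re (g x x)"
    using b(2) by (simp add: zero_le_mult_iff)
  also have "\<dots> = (norm_of g x * norm_of g y)\<^sup>2"
    by (simp add: power_mult_distrib norm_of_square b_def mult.commute)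
  finally show ?thesis
    by (rule power2_le_imp_le) (simp add: norm_of_nonneg)
qed (simp add: norm_of_def)

end

section \<open>Equivalent scalar products and the real-linear structure\<close>

lemma equivalent_scalar_productE:
  assumes "equivalent_scalar_product g"
  obtains c C where "scalar_product g" "c > 0" "C > 0"
    "\<And>x. c * norm x \<le> norm_of g x" "\<And>x. norm_of g x \<le> C * norm x"
  using assms unfolding equivalent_scalar_product_def by blast

text \<open>A scalar product is conjugate linear in its second argument, hence bilinear over the
  reals, and Cauchy-Schwarz bounds it. This makes the limit and product rules available for
  \<open>g\<close>.\<close>

lemma bounded_bilinear_equivalent_scalar_product:
  assumes "equivalent_scalar_product g"
  shows "bounded_bilinear g"
proof -
  obtain c C where g: "scalar_product g" "C > 0" "\<And>x. norm_of g x \<le> C * norm x"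
    using equivalent_scalar_productE[OF assms] by metis
  interpret scalar_product g by (rule g)
  show ?thesis
  proof
    show "\<exists>K. \<forall>a b. norm (g a b) \<le> norm a * norm b * K"
    proof (intro exI allI)
      fix a b
      have "norm (g a b) \<le> norm_of g a * norm_of g b" by (rule Cauchy_Schwarz)
      also have "\<dots> \<le> (C * norm a) * (C * norm b)"
        using g by (intro mult_mono g norm_of_nonneg) auto
      finally show "norm (g a b) \<le> norm a * norm b * (C * C)" by (simp add: mult_ac)
    qed
  qed (simp_all add: add_left add_right scaleR_left scaleR_right)
qed

interpretation cinner: scalar_product "cinner :: 'a::complex_hilbert_space \<Rightarrow> 'a \<Rightarrow> complex"
  by (rule scalar_product_cinner)

lemma norm_of_cinner: "norm_of cinner (x :: 'a::complex_hilbert_space) = norm x"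
  by (simp add: norm_of_def norm_eq_sqrt_cinner)

lemma equivalent_scalar_product_cinner:
  "equivalent_scalar_product (cinner :: 'a::complex_hilbert_space \<Rightarrow> 'a \<Rightarrow> complex)"
  unfolding equivalent_scalar_product_def norm_of_cinner
  using scalar_product_cinner by (auto intro!: exI[of _ "1::real"])

interpretation bounded_cinner:
  bounded_bilinear "cinner :: 'a::complex_hilbert_space \<Rightarrow> 'a \<Rightarrow> complex"
  by (rule bounded_bilinear_equivalent_scalar_product) (rule equivalent_scalar_product_cinner)

lemma norm_cinner_le: "norm (cinner x y) \<le> norm x * norm (y :: 'a::complex_hilbert_space)"
  using cinner.Cauchy_Schwarz[of x y] by (simp add: norm_of_cinner)

lemma Re_cinner_self: "Re (cinner x x) = (norm (x :: 'a::complex_hilbert_space))\<^sup>2"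
  using cinner.norm_of_square[of x] by (simp add: norm_of_cinner)

text \<open>The class axioms state homogeneity of the norm for real scalars; the scalar product
  extends it to complex ones.\<close>

lemma norm_scaleC: "norm (c *\<^sub>C x) = norm c * norm (x :: 'a::complex_hilbert_space)"
proof -
  have "cinner (c *\<^sub>C x) (c *\<^sub>C x) = of_real ((norm c)\<^sup>2) * cinner x x"
    by (simp only: cinner.scaleC_left cinner.scaleC_right complex_norm_square mult_ac)
  then have "(norm (c *\<^sub>C x))\<^sup>2 = (norm c * norm x)\<^sup>2"
    by (simp add: Re_cinner_self[symmetric] power_mult_distrib del: of_real_power)
  then show ?thesis by (simp add: power2_eq_iff_nonneg)
qed

lemma bounded_linear_scaleC: "bounded_linear ((*\<^sub>C) c :: 'a::complex_hilbert_space \<Rightarrow> 'a)"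
  by (rule bounded_linear_intro[of _ "norm c"])
     (simp_all add: scaleC_add_right scaleC_scaleR norm_scaleC mult.commute)

lemma bounded_clinear_scaleC: "bounded_clinear f \<Longrightarrow> f (c *\<^sub>C x) = c *\<^sub>C f x"
  unfolding bounded_clinear_def Vector_Spaces.linear_def module_hom_def module_hom_axioms_def by blast

text \<open>Forgets the complex structure, so that limits, derivatives and integrals can be moved
  through \<open>f\<close>.\<close>

lemma bounded_clinear_imp_bounded_linear:
  assumes "bounded_clinear f"
  shows "bounded_linear f"
proof -
  obtain K where K: "\<And>x. norm (f x) \<le> K * norm x"
    using assms by (auto simp: bounded_clinear_def)
  have add: "f (x + y) = f x + f y" for x y
    using assms unfolding bounded_clinear_def Vector_Spaces.linear_def module_hom_def
      module_hom_axioms_def by blast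
  show ?thesis
    using K by (intro bounded_linear_intro[of f K])
      (simp_all add: add scaleR_scaleC bounded_clinear_scaleC[OF assms] mult.commute)
qed

section \<open>Local bounds and continuity of semigroup orbits\<close>

context C0_semigroup
begin

lemma bounded_linear: "0 \<le> t \<Longrightarrow> bounded_linear (T t)"
  by (rule bounded_clinear_imp_bounded_linear) (rule bounded_clinear)

text \<open>Otherwise there are times \<open>s n\<close> tending to 0 at which the norm of
  \<open>T (s n)\<close> exceeds \<open>n\<close>. As \<open>T (s n) x\<close> converges to
  \<open>x\<close> for each \<open>x\<close>, this contradicts uniform boundedness.\<close>

lemma bounded_near_zero:
  obtains \<delta> M where "\<delta> > 0" "M \<ge> 1" "\<And>t x. 0 \<le> t \<Longrightarrow> t \<le> \<delta> \<Longrightarrow> norm (T t x) \<le> M * norm x"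
proof -
  have "\<exists>\<delta>>0. \<exists>M. \<forall>t x. 0 \<le> t \<and> t \<le> \<delta> \<longrightarrow> norm (T t x) \<le> M * norm x"
  proof (rule ccontr)
    assume "\<not> ?thesis"
    then have "\<forall>n. \<exists>t x. 0 \<le> t \<and> t \<le> 1 / real (Suc n) \<and> norm (T t x) > real n * norm x"
      by (metis not_le of_nat_0_less_iff zero_less_Suc zero_less_divide_1_iff)
    then obtain s y where s: "\<And>n. 0 \<le> s n" "\<And>n. s n \<le> 1 / real (Suc n)"
      and y: "\<And>n. norm (T (s n) (y n)) > real n * norm (y n)" by metis
    have lim: "s \<longlonglongrightarrow> 0"
      by (rule tendsto_sandwich[OF _ _ tendsto_const LIMSEQ_Suc[OF lim_1_over_n]])
         (use s in \<open>auto intro!: always_eventually\<close>)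
    have "\<exists>C. \<forall>n\<in>UNIV. norm (T (s n) x) \<le> C" for x
    proof -
      \<comment> \<open>Some \<open>s n\<close> may equal 0, so the right limit is first turned into
        continuity at 0 by means of \<open>T 0 x = x\<close>.\<close>
      have "((\<lambda>t. T t x) \<longlongrightarrow> x) (at 0 within {0..})"
        unfolding at_within_Ici_at_right using strongly_continuous .
      then have "continuous (at 0 within {0..}) (\<lambda>t. T t x)"
        by (simp add: continuous_within zero)
      then have "(\<lambda>n. T (s n) x) \<longlonglongrightarrow> T 0 x"
        using s lim by (auto simp: continuous_within_sequentially o_def)
      then have "bounded (range (\<lambda>n. T (s n) x))"
        by (rule convergent_imp_bounded)
      then show ?thesis by (auto simp: bounded_iff)
    qed
    then obtain C where C: "\<And>n x. norm (T (s n) x) \<le> C * norm x"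
      using uniform_boundedness[of UNIV "\<lambda>n. T (s n)"] bounded_linear[OF s(1)] by (metis UNIV_I)
    obtain n where "C \<le> real n" using real_arch_simple by blast
    then have "norm (T (s n) (y n)) \<le> real n * norm (y n)"
      using C[of n "y n"] by (meson mult_right_mono norm_ge_zero order_trans)
    with y[of n] show False by simp
  qed
  then obtain \<delta> M where "\<delta> > 0" and M: "\<And>t x. 0 \<le> t \<Longrightarrow> t \<le> \<delta> \<Longrightarrow> norm (T t x) \<le> M * norm x"
    by blast
  show ?thesis
  \<comment> \<open>A constant of at least 1 has nondecreasing powers, as needed when the bound is
    iterated.\<close>
  proof (rule that[of \<delta> "max 1 M"])
    fix t x assume "0 \<le> t" "t \<le> \<delta>"
    then have "norm (T t x) \<le> M * norm x" by (rule M)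
    also have "\<dots> \<le> max 1 M * norm x" by (simp add: mult_right_mono)
    finally show "norm (T t x) \<le> max 1 M * norm x" .
  qed (use \<open>\<delta> > 0\<close> in auto)
qed

text \<open>The semigroup law cuts the time into pieces of length at most \<open>\<delta>\<close>,
  each of which costs a factor \<open>M\<close>.\<close>

lemma bounded_on_interval:
  obtains M where "M \<ge> 1" "\<And>t x. 0 \<le> t \<Longrightarrow> t \<le> b \<Longrightarrow> norm (T t x) \<le> M * norm x"
proof -
  obtain \<delta> M where \<delta>: "\<delta> > 0" and M: "M \<ge> 1"
    and *: "\<And>t x. 0 \<le> t \<Longrightarrow> t \<le> \<delta> \<Longrightarrow> norm (T t x) \<le> M * norm x"
    using bounded_near_zero by blast
  have **: "norm (T t x) \<le> M ^ Suc n * norm x" if "0 \<le> t" "t \<le> real (Suc n) * \<delta>" for n t x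
    using that
  proof (induction n arbitrary: t)
    case 0
    then show ?case using * by simp
  next
    case (Suc n)
    show ?case
    proof (cases "t \<le> \<delta>")
      case True
      have "norm (T t x) \<le> M * norm x" using * True Suc by simp
      also have "\<dots> \<le> M ^ Suc (Suc n) * norm x"
        using M by (intro mult_right_mono self_le_power) auto
      finally show ?thesis .
    next
      case False
      have "norm (T t x) = norm (T \<delta> (T (t - \<delta>) x))"
        using add[of \<delta> "t - \<delta>" x] False \<delta> by simp
      also have "\<dots> \<le> M * norm (T (t - \<delta>) x)" using * \<delta> by simp
      also have "\<dots> \<le> M * (M ^ Suc n * norm x)"
        using Suc.prems False M by (intro mult_left_mono Suc.IH) (auto simp: algebra_simps)
      finally show ?thesis by (simp add: mult_ac)
    qed
  qed
  obtain n where "b / \<delta> \<le> real n" using real_arch_simple by blast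
  then have n: "b \<le> real (Suc n) * \<delta>" using \<delta> by (simp add: field_simps)
  show ?thesis
  proof (rule that[of "M ^ Suc n"])
    show "M ^ Suc n \<ge> 1" using M by (rule one_le_power)
  qed (use ** n in force)
qed

lemma continuous_on_orbit: "continuous_on {0..b} (\<lambda>t. T t x)"
proof -
  obtain M where M: "M \<ge> 1" "\<And>t x. 0 \<le> t \<Longrightarrow> t \<le> b \<Longrightarrow> norm (T t x) \<le> M * norm x"
    using bounded_on_interval by blast
  \<comment> \<open>Factoring out the earlier operator \<open>T s\<close> reduces continuity from
    both sides to right continuity at 0.\<close>
  have diff: "norm (T t x - T s x) \<le> M * norm (T (t - s) x - x)" if "0 \<le> s" "s \<le> t" "t \<le> b" for s t
  proof -
    have "T t x - T s x = T s (T (t - s) x - x)"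
      using add[of s "t - s" x] that bounded_linear[of s]
      by (simp add: linear_diff bounded_linear.linear)
    then show ?thesis using M that by simp
  qed
  show ?thesis
    unfolding continuous_on_iff
  proof (intro ballI allI impI)
    fix t e :: real assume t: "t \<in> {0..b}" and e: "e > 0"
    have "eventually (\<lambda>h. dist (T h x) x < e / M) (at_right 0)"
      using strongly_continuous e M(1) by (intro tendstoD) auto
    then obtain d where d: "d > 0" "\<And>h. 0 < h \<Longrightarrow> h < d \<Longrightarrow> dist (T h x) x < e / M"
      unfolding eventually_at_right_field by auto
    have d': "norm (T h x - x) < e / M" if "0 \<le> h" "h < d" for h
      using d that e M(1) by (cases "h = 0") (auto simp: zero dist_norm)
    show "\<exists>d>0. \<forall>x'\<in>{0..b}. dist x' t < d \<longrightarrow> dist (T x' x) (T t x) < e"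
    proof (intro exI[of _ d] conjI ballI impI d)
      fix s assume s: "s \<in> {0..b}" "dist s t < d"
      \<comment> \<open>\<open>max\<close> and \<open>min\<close> treat \<open>s < t\<close> and
        \<open>t < s\<close> together.\<close>
      have "norm (T (max s t) x - T (min s t) x) \<le> M * norm (T (max s t - min s t) x - x)"
        using s t by (intro diff) auto
      also have "\<dots> < M * (e / M)"
        using s t M(1) by (intro mult_strict_left_mono d') (auto simp: dist_real_def)
      finally show "dist (T s x) (T t x) < e"
        using M(1) by (auto simp: dist_norm max_def min_def norm_minus_commute split: if_splits)
    qed
  qed
qed

section \<open>Integrals of orbits\<close>

lemma orbit_integrable: "0 \<le> a \<Longrightarrow> (\<lambda>s. T s x) integrable_on {a..b}"
  by (rule integrable_continuous_real) (auto intro: continuous_on_subset[OF continuous_on_orbit[of b]])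

text \<open>The fundamental theorem of calculus, phrased with the one-sided difference quotients
  that define the generator.\<close>

lemma orbit_integral_derivative:
  assumes "0 \<le> t"
  shows "((\<lambda>h. (integral {0..t+h} (\<lambda>s. T s x) - integral {0..t} (\<lambda>s. T s x)) /\<^sub>R h) \<longlongrightarrow> T t x) (at_right 0)"
proof -
  define F where "F u = integral {0..u} (\<lambda>s. T s x)" for u
  have "(F has_vector_derivative T t x) (at t within {0..t+1})"
    unfolding F_def using assms by (intro integral_has_vector_derivative continuous_on_orbit) auto
  \<comment> \<open>In this smaller interval \<open>t\<close> is the left endpoint, so the
    derivative becomes a limit along \<open>at_right t\<close>.\<close>
  then have "(F has_vector_derivative T t x) (at t within {t..t+1})"
    by (rule has_vector_derivative_within_subset) (use assms in auto)
  then have "((\<lambda>u. (F u - F t - (u - t) *\<^sub>R T t x) /\<^sub>R norm (u - t)) \<longlongrightarrow> 0) (at_right t)"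
    by (simp add: has_vector_derivative_def has_derivative_within at_within_Icc_at_right diff_diff_eq divide_inverse)
  then have "((\<lambda>h. (F (t + h) - F t - h *\<^sub>R T t x) /\<^sub>R norm h) \<longlongrightarrow> 0) (at_right 0)"
    unfolding filterlim_at_right_to_0[of _ _ t] by (simp add: add.commute)
  moreover have "eventually (\<lambda>h. (F (t + h) - F t - h *\<^sub>R T t x) /\<^sub>R norm h
      = (F (t + h) - F t) /\<^sub>R h - T t x) (at_right 0)"
    using eventually_at_right_less[of "0::real"]
    by eventually_elim (simp add: scaleR_diff_right)
  ultimately have "((\<lambda>h. (F (t + h) - F t) /\<^sub>R h - T t x) \<longlongrightarrow> 0) (at_right 0)"
    by (rule Lim_transform_eventually)
  then show ?thesis
    unfolding F_def by (rule Lim_null[THEN iffD2])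
qed

text \<open>Moving \<open>T h\<close> under the integral shifts the interval by \<open>h\<close>.
  The common part cancels, and the two end pieces of length \<open>h\<close>, divided by
  \<open>h\<close>, tend to \<open>T t x\<close> and \<open>x\<close>.\<close>

lemma integral_orbit_generator:
  assumes "0 \<le> t"
  shows "((\<lambda>h. (T h (integral {0..t} (\<lambda>s. T s x)) - integral {0..t} (\<lambda>s. T s x)) /\<^sub>R h)
    \<longlongrightarrow> T t x - x) (at_right 0)"
proof -
  define F where "F u = integral {0..u} (\<lambda>s. T s x)" for u
  \<comment> \<open>The form \<open>0 + h\<close> matches the derivative of \<open>F\<close> at time
    0.\<close>
  have *: "T h (F t) - F t = (F (t + h) - F t) - (F (0 + h) - F 0)" if "0 < h" for h
  proof -
    have "T h (F t) = integral {0..t} (T h \<circ> (\<lambda>s. T s x))"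
      unfolding F_def using integral_linear[OF orbit_integrable bounded_linear] that by simp
    also have "\<dots> = integral {0..t} ((\<lambda>s. T s x) \<circ> (+) h)"
      by (rule integral_cong) (use that in \<open>simp add: add\<close>)
    also have "\<dots> = integral {h..t+h} (\<lambda>s. T s x)"
      by (simp add: integral_shift_Icc_real)
    also have "\<dots> = F (t + h) - F h"
      using Henstock_Kurzweil_Integration.integral_combine[where a=0 and c=h and b="t + h" and f="\<lambda>s. T s x"] that assms
      by (simp add: F_def orbit_integrable algebra_simps)
    finally show ?thesis by (simp add: F_def)
  qed
  have "((\<lambda>h. (F (t + h) - F t) /\<^sub>R h - (F (0 + h) - F 0) /\<^sub>R h) \<longlongrightarrow> T t x - T 0 x) (at_right 0)"
    unfolding F_def by (intro tendsto_diff orbit_integral_derivative assms order_refl)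
  moreover have "eventually (\<lambda>h. (F (t + h) - F t) /\<^sub>R h - (F (0 + h) - F 0) /\<^sub>R h
      = (T h (F t) - F t) /\<^sub>R h) (at_right 0)"
    using eventually_at_right_less[of "0::real"]
    by eventually_elim (simp only: * scaleR_diff_right)
  ultimately show ?thesis
    unfolding zero F_def[symmetric] by (rule Lim_transform_eventually)
qed

section \<open>Linearity, density and boundedness of the generator\<close>

lemma generatorD: "generator T D A \<Longrightarrow> x \<in> D \<Longrightarrow> ((\<lambda>h. (T h x - x) /\<^sub>R h) \<longlongrightarrow> A x) (at_right 0)"
  by (simp add: generator_def)

lemma generatorI:
  assumes "generator T D A" "((\<lambda>h. (T h x - x) /\<^sub>R h) \<longlongrightarrow> y) (at_right 0)"
  shows "x \<in> D" "A x = y"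
proof -
  show "x \<in> D" using assms by (auto simp: generator_def)
  then show "A x = y"
    using generatorD[OF assms(1)] assms(2) by (intro tendsto_unique[OF trivial_limit_at_right_real])
qed

lemma generator_add:
  assumes "generator T D A" "x \<in> D" "y \<in> D"
  shows "x + y \<in> D" "A (x + y) = A x + A y"
proof -
  have "((\<lambda>h. (T h x - x) /\<^sub>R h + (T h y - y) /\<^sub>R h) \<longlongrightarrow> A x + A y) (at_right 0)"
    using assms by (intro tendsto_add generatorD)
  moreover have "eventually (\<lambda>h. (T h x - x) /\<^sub>R h + (T h y - y) /\<^sub>R h
      = (T h (x + y) - (x + y)) /\<^sub>R h) (at_right 0)"
    using eventually_at_right_less[of "0::real"]
  proof eventually_elim
    case (elim h)
    then interpret bounded_linear "T h" by (intro bounded_linear) auto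
    show ?case by (simp add: add algebra_simps)
  qed
  ultimately have "((\<lambda>h. (T h (x + y) - (x + y)) /\<^sub>R h) \<longlongrightarrow> A x + A y) (at_right 0)"
    by (rule Lim_transform_eventually)
  then show "x + y \<in> D" "A (x + y) = A x + A y" using generatorI[OF assms(1)] by auto
qed

lemma generator_scaleC:
  assumes "generator T D A" "x \<in> D"
  shows "c *\<^sub>C x \<in> D" "A (c *\<^sub>C x) = c *\<^sub>C A x"
proof -
  have "((\<lambda>h. c *\<^sub>C ((T h x - x) /\<^sub>R h)) \<longlongrightarrow> c *\<^sub>C A x) (at_right 0)"
    using assms by (intro bounded_linear.tendsto[OF bounded_linear_scaleC] generatorD)
  moreover have "eventually (\<lambda>h. c *\<^sub>C ((T h x - x) /\<^sub>R h)
      = (T h (c *\<^sub>C x) - c *\<^sub>C x) /\<^sub>R h) (at_right 0)"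
    using eventually_at_right_less[of "0::real"]
    by eventually_elim
       (simp add: bounded_clinear_scaleC[OF bounded_clinear] scaleC_scaleR scaleC_diff_right)
  ultimately have "((\<lambda>h. (T h (c *\<^sub>C x) - c *\<^sub>C x) /\<^sub>R h) \<longlongrightarrow> c *\<^sub>C A x) (at_right 0)"
    by (rule Lim_transform_eventually)
  then show "c *\<^sub>C x \<in> D" "A (c *\<^sub>C x) = c *\<^sub>C A x" using generatorI[OF assms(1)] by auto
qed

lemma generator_scaleR:
  assumes "generator T D A" "x \<in> D"
  shows "r *\<^sub>R x \<in> D" "A (r *\<^sub>R x) = r *\<^sub>R A x"
  using generator_scaleC[OF assms] by (simp_all add: scaleR_scaleC)

lemma generator_orbit_integral:
  assumes "generator T D A" "0 \<le> t"
  shows "integral {0..t} (\<lambda>s. T s x) \<in> D" "A (integral {0..t} (\<lambda>s. T s x)) = T t x - x"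
  using generatorI[OF assms(1) integral_orbit_generator[OF assms(2)]] by blast+

lemma orbit_mean_tendsto: "((\<lambda>t. integral {0..t} (\<lambda>s. T s x) /\<^sub>R t) \<longlongrightarrow> x) (at_right 0)"
  using orbit_integral_derivative[of 0 x] by (simp add: zero)

lemma generator_orbit_mean:
  assumes "generator T D A" "0 \<le> t"
  shows "integral {0..t} (\<lambda>s. T s x) /\<^sub>R t \<in> D"
    and "A (integral {0..t} (\<lambda>s. T s x) /\<^sub>R t) = (T t x - x) /\<^sub>R t"
  using generator_scaleR[OF assms(1) generator_orbit_integral(1)[OF assms]]
    generator_orbit_integral(2)[OF assms] by simp_all

text \<open>Orbit means lie in the domain and converge to \<open>x\<close>.\<close>

lemma generator_dense:
  assumes "generator T D A"
  shows "closure D = UNIV"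
proof -
  have "x \<in> closure D" for x
  proof (rule Lim_in_closed_set[OF closed_closure _ _ orbit_mean_tendsto[of x]])
    show "eventually (\<lambda>t. integral {0..t} (\<lambda>s. T s x) /\<^sub>R t \<in> closure D) (at_right 0)"
      using eventually_at_right_less[of "0::real"]
    proof eventually_elim
      case (elim t)
      then have "integral {0..t} (\<lambda>s. T s x) /\<^sub>R t \<in> D"
        by (intro generator_orbit_mean(1)[OF assms]) simp
      then show ?case by (rule subsetD[OF closure_subset])
    qed
  qed simp
  then show ?thesis by auto
qed

text \<open>On the domain \<open>A\<close> is Lipschitz, so it sends the convergent orbit means
  \<open>m t\<close> of an arbitrary \<open>x\<close> to convergent values. These values are the
  difference quotients at \<open>x\<close>, whence \<open>x \<in> D\<close>.\<close>

lemma generator_bounded_imp_bounded_operator: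
  assumes gen: "generator T D A" and bound: "\<And>x. x \<in> D \<Longrightarrow> norm (A x) \<le> C * norm x"
  shows "bounded_operator D A"
proof -
  have D: "x \<in> D" for x
  proof -
    define m where "m t = integral {0..t} (\<lambda>s. T s x) /\<^sub>R t" for t
    have m: "(m \<longlongrightarrow> x) (at_right 0)" unfolding m_def by (rule orbit_mean_tendsto)
    have mD: "m t \<in> D" "A (m t) = (T t x - x) /\<^sub>R t" if "0 \<le> t" for t
      unfolding m_def using generator_orbit_mean[OF gen that] by auto
    have diff: "norm (A (m t) - A (m s)) \<le> C * norm (m t - m s)" if "0 \<le> s" "0 \<le> t" for s t
      using bound[of "m t + (-1) *\<^sub>R m s"] that mD(1)[of t] mD(1)[of s]
      by (simp add: generator_add[OF gen] generator_scaleR[OF gen] del: scaleR_minus_left scaleR_minus1_left)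
         simp
    define s where "s n = inverse (real (Suc n))" for n
    have s: "filterlim s (at_right 0) sequentially"
      unfolding filterlim_at s_def using LIMSEQ_inverse_real_of_nat by simp
    have s0: "0 \<le> s n" for n by (simp add: s_def)
    have ms: "(\<lambda>n. m (s n)) \<longlonglongrightarrow> x" by (rule filterlim_compose[OF m s])
    have "Cauchy (\<lambda>n. A (m (s n)))"
    proof (rule metric_CauchyI)
      fix e :: real assume "e > 0"
      \<comment> \<open>\<open>C\<close> may be zero or negative, hence the divisor
        \<open>\<bar>C\<bar> + 1\<close>.\<close>
      then have "e / (\<bar>C\<bar> + 1) > 0" by simp
      then obtain N where N: "\<forall>n\<ge>N. \<forall>k\<ge>N. dist (m (s n)) (m (s k)) < e / (\<bar>C\<bar> + 1)"
        using LIMSEQ_imp_Cauchy[OF ms] unfolding Cauchy_def by blast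
      show "\<exists>N. \<forall>n\<ge>N. \<forall>k\<ge>N. dist (A (m (s n))) (A (m (s k))) < e"
      proof (intro exI[of _ N] allI impI)
        fix n k assume "n \<ge> N" "k \<ge> N"
        have "dist (A (m (s n))) (A (m (s k))) \<le> (\<bar>C\<bar> + 1) * dist (m (s n)) (m (s k))"
          unfolding dist_norm by (rule order_trans[OF diff[OF s0 s0]] mult_right_mono)+ auto
        also have "\<dots> < (\<bar>C\<bar> + 1) * (e / (\<bar>C\<bar> + 1))"
          using N \<open>n \<ge> N\<close> \<open>k \<ge> N\<close> by (intro mult_strict_left_mono) auto
        finally show "dist (A (m (s n))) (A (m (s k))) < e" by simp
      qed
    qed
    then obtain z where z: "(\<lambda>n. A (m (s n))) \<longlonglongrightarrow> z"
      by (auto simp: Cauchy_convergent_iff convergent_def)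
    \<comment> \<open>Letting only the second mean run along \<open>s n\<close> passes from the
      sequence to every \<open>t\<close>.\<close>
    have lim: "norm (A (m t) - z) \<le> C * norm (m t - x)" if "0 \<le> t" for t
    proof (rule LIMSEQ_le)
      show "(\<lambda>n. norm (A (m t) - A (m (s n)))) \<longlonglongrightarrow> norm (A (m t) - z)"
        by (intro tendsto_intros z)
      show "(\<lambda>n. C * norm (m t - m (s n))) \<longlonglongrightarrow> C * norm (m t - x)"
        by (intro tendsto_intros ms)
    qed (use diff[OF s0 that] in blast)
    have "((\<lambda>t. C * norm (m t - x)) \<longlongrightarrow> C * norm (x - x)) (at_right 0)"
      by (intro tendsto_intros m)
    then have "((\<lambda>t. C * norm (m t - x)) \<longlongrightarrow> 0) (at_right 0)" by simp
    moreover have "eventually (\<lambda>t. norm ((T t x - x) /\<^sub>R t - z) \<le> C * norm (m t - x)) (at_right 0)"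
      using eventually_at_right_less[of "0::real"]
    proof eventually_elim
      case (elim t)
      then show ?case using lim[of t] mD(2)[of t] by simp
    qed
    ultimately have "((\<lambda>t. (T t x - x) /\<^sub>R t - z) \<longlongrightarrow> 0) (at_right 0)"
      by (rule Lim_null_comparison[rotated])
    then show "x \<in> D" using generatorI[OF gen] Lim_null by blast
  qed
  have "vector_space (scaleC :: complex \<Rightarrow> 'a \<Rightarrow> 'a)"
    by unfold_locales (simp_all add: scaleC_add_left scaleC_add_right scaleC_scaleC scaleC_one)
  then have "Vector_Spaces.linear scaleC scaleC A"
    using generator_add(2)[OF gen D D] generator_scaleC(2)[OF gen D]
    by (simp add: Vector_Spaces.linear_iff)
  then show ?thesis
    using bound D by (auto simp: bounded_operator_def bounded_clinear_def)
qed

section \<open>Growth of orbits in an equivalent norm\<close>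

text \<open>The orbit equals \<open>x\<close> plus \<open>A\<close> applied to its own integral, and
  a bounded \<open>A\<close> commutes with the derivative of that integral.\<close>

lemma bounded_generator_orbit_derivative:
  assumes gen: "generator T D A" and bdd: "bounded_operator D A" and t: "t \<in> {0..b}"
  shows "((\<lambda>t. T t x) has_vector_derivative A (T t x)) (at t within {0..b})"
proof -
  have A: "bounded_linear A" using bdd by (simp add: bounded_operator_def bounded_clinear_imp_bounded_linear)
  have "((\<lambda>u. integral {0..u} (\<lambda>s. T s x)) has_vector_derivative T t x) (at t within {0..b})"
    using t by (intro integral_has_vector_derivative continuous_on_orbit)
  then have "((\<lambda>u. A (integral {0..u} (\<lambda>s. T s x))) has_vector_derivative A (T t x)) (at t within {0..b})"
    by (rule bounded_linear.has_vector_derivative[OF A])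
  then have "((\<lambda>u. A (integral {0..u} (\<lambda>s. T s x)) + x) has_vector_derivative A (T t x)) (at t within {0..b})"
    by (simp only: has_vector_derivative_add_const)
  moreover have "T s x = A (integral {0..s} (\<lambda>s. T s x)) + x" if "s \<in> {0..b}" for s
    using generator_orbit_integral(2)[OF gen] that by simp
  ultimately show ?thesis
    by (rule has_vector_derivative_transform[OF t, rotated])
qed

text \<open>A Gronwall argument: the squared \<open>g\<close>-norm \<open>f\<close> of an orbit
  satisfies \<open>f' \<le> 2 \<omega> f\<close>, so \<open>exp (- 2 \<omega> s) f s\<close> does
  not increase.\<close>

lemma bounded_operator_imp_quasi_contractive:
  assumes gen: "generator T D A" and bdd: "bounded_operator D A" and g: "equivalent_scalar_product g"
  shows "quasi_contractive g T"
proof -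
  obtain c where c: "scalar_product g" "c > 0" "\<And>x. c * norm x \<le> norm_of g x"
    using equivalent_scalar_productE[OF g] by metis
  interpret g: scalar_product g by (rule c)
  interpret bg: bounded_bilinear g by (rule bounded_bilinear_equivalent_scalar_product[OF g])
  interpret A: bounded_linear A
    using bdd by (simp add: bounded_operator_def bounded_clinear_imp_bounded_linear)
  obtain K where K: "K \<ge> 0" "\<And>x. norm (A x) \<le> norm x * K" using A.nonneg_bounded by blast
  obtain B where B: "B \<ge> 0" "\<And>x y. norm (g x y) \<le> norm x * norm y * B" using bg.nonneg_bounded by blast
  \<comment> \<open>\<open>K\<close> bounds \<open>A\<close>, \<open>B\<close> bounds
    \<open>g\<close>, and division by the square of \<open>c\<close> passes from the original norm
    to that of \<open>g\<close>.\<close>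
  define \<omega> where "\<omega> = K * B / c\<^sup>2"
  have \<omega>: "Re (g (A x) x) \<le> \<omega> * Re (g x x)" for x
  proof -
    have "Re (g (A x) x) \<le> norm (A x) * norm x * B"
      using B(2)[of "A x" x] complex_Re_le_cmod order_trans by blast
    also have "\<dots> \<le> (norm x * K) * norm x * B"
      using K B by (intro mult_right_mono) auto
    also have "\<dots> = \<omega> * (c * norm x)\<^sup>2"
      using c by (simp add: \<omega>_def power2_eq_square)
    also have "\<dots> \<le> \<omega> * (norm_of g x)\<^sup>2"
      using K B c by (intro mult_left_mono power_mono) (auto simp: \<omega>_def)
    finally show ?thesis by (simp add: g.norm_of_square)
  qed
  show ?thesis
    unfolding quasi_contractive_def
  proof (intro exI allI impI)
    fix t :: real and x assume t: "0 \<le> t"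
    define f where "f s = Re (g (T s x) (T s x))" for s
    define f' where "f' s = 2 * Re (g (A (T s x)) (T s x))" for s
    have f: "(f has_real_derivative f' s) (at s within {0..t})" if "s \<in> {0..t}" for s
    proof -
      note d = bounded_generator_orbit_derivative[OF gen bdd that, of x]
      have "((\<lambda>s. Re (g (T s x) (T s x))) has_vector_derivative
          Re (g (T s x) (A (T s x)) + g (A (T s x)) (T s x))) (at s within {0..t})"
        by (intro bounded_linear.has_vector_derivative[OF bounded_linear_Re] bg.has_vector_derivative d)
      moreover have "Re (g (T s x) (A (T s x))) = Re (g (A (T s x)) (T s x))"
        using g.commute[of "T s x" "A (T s x)"] by simp
      ultimately show ?thesis
        by (simp add: f_def[abs_def] f'_def has_real_derivative_iff_has_vector_derivative)
    qed
    define h where "h s = exp (- 2 * \<omega> * s) * f s" for s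
    have h: "(h has_real_derivative exp (- 2 * \<omega> * s) * (f' s - 2 * \<omega> * f s)) (at s within {0..t})"
      if "s \<in> {0..t}" for s
      unfolding h_def[abs_def]
      by (rule derivative_eq_intros f[OF that] refl)+ (simp add: algebra_simps)
    have "h t \<le> h 0"
    proof (rule DERIV_nonpos_imp_decreasing_open[OF t])
      fix s assume s: "0 < s" "s < t"
      then have "at s within {0..t} = at s" by (simp add: at_within_Icc_at)
      then have "DERIV h s :> exp (- 2 * \<omega> * s) * (f' s - 2 * \<omega> * f s)" using h[of s] s by simp
      moreover have "exp (- 2 * \<omega> * s) * (f' s - 2 * \<omega> * f s) \<le> 0"
        using \<omega>[of "T s x"] by (simp add: mult_le_0_iff f_def f'_def)
      ultimately show "\<exists>y. DERIV h s :> y \<and> y \<le> 0" by blast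
    next
      show "continuous_on {0..t} h" using h by (rule DERIV_continuous_on)
    qed
    then have "exp (2 * \<omega> * t) * h t \<le> exp (2 * \<omega> * t) * f 0" by (simp add: h_def)
    then have "f t \<le> exp (2 * \<omega> * t) * f 0"
      by (simp add: h_def mult.assoc[symmetric] exp_add[symmetric])
    also have "\<dots> = (exp (\<omega> * t))\<^sup>2 * f 0"
      by (simp add: exp_double[symmetric] mult_ac)
    finally have "(norm_of g (T t x))\<^sup>2 \<le> (exp (\<omega> * t) * norm_of g x)\<^sup>2"
      by (simp add: power_mult_distrib g.norm_of_square f_def zero)
    then show "norm_of g (T t x) \<le> exp (\<omega> * t) * norm_of g x"
      by (rule power2_le_imp_le) (simp add: g.norm_of_nonneg)
  qed
qed

text \<open>Cauchy-Schwarz and quasi-contractivity give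
  \<open>Re (g (T h x) x) \<le> exp (\<omega> h) Re (g x x)\<close>, with equality at
  \<open>h = 0\<close>; the claim compares the right derivatives there.\<close>

lemma quasi_contractive_imp_quasi_dissipative:
  assumes gen: "generator T D A" and g: "equivalent_scalar_product g" and "quasi_contractive g T"
  obtains \<omega> where "\<And>x. x \<in> D \<Longrightarrow> Re (g (A x) x) \<le> \<omega> * Re (g x x)"
proof -
  obtain \<omega> where \<omega>: "\<And>t x. 0 \<le> t \<Longrightarrow> norm_of g (T t x) \<le> exp (\<omega> * t) * norm_of g x"
    using assms(3) unfolding quasi_contractive_def by blast
  interpret g: scalar_product g using equivalent_scalar_productE[OF g] by metis
  interpret bg: bounded_bilinear g by (rule bounded_bilinear_equivalent_scalar_product[OF g])
  have exp_lim: "((\<lambda>h. (exp (\<omega> * h) - 1) / h) \<longlongrightarrow> \<omega>) (at_right 0)"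
  proof -
    have "((\<lambda>h. exp (\<omega> * h)) has_real_derivative \<omega>) (at 0)"
      by (auto intro!: derivative_eq_intros)
    then have "((\<lambda>h. (exp (\<omega> * h) - 1) / h) \<longlongrightarrow> \<omega>) (at 0)" by (simp add: DERIV_def)
    then show ?thesis by (rule filterlim_mono) (simp_all add: at_le)
  qed
  show ?thesis
  proof (rule that)
    fix x assume x: "x \<in> D"
    show "Re (g (A x) x) \<le> \<omega> * Re (g x x)"
    proof (rule tendsto_le[OF trivial_limit_at_right_real])
      show "((\<lambda>h. (exp (\<omega> * h) - 1) / h * Re (g x x)) \<longlongrightarrow> \<omega> * Re (g x x)) (at_right 0)"
        by (intro tendsto_intros exp_lim)
      show "((\<lambda>h. Re (g ((T h x - x) /\<^sub>R h) x)) \<longlongrightarrow> Re (g (A x) x)) (at_right 0)"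
        by (intro tendsto_Re bg.tendsto tendsto_const generatorD[OF gen x])
      show "eventually (\<lambda>h. Re (g ((T h x - x) /\<^sub>R h) x) \<le> (exp (\<omega> * h) - 1) / h * Re (g x x)) (at_right 0)"
        using eventually_at_right_less[of "0::real"]
      proof eventually_elim
        case (elim h)
        have "Re (g (T h x) x) \<le> norm_of g (T h x) * norm_of g x"
          using g.Cauchy_Schwarz complex_Re_le_cmod order_trans by blast
        also have "\<dots> \<le> exp (\<omega> * h) * norm_of g x * norm_of g x"
          using elim by (intro mult_right_mono \<omega> g.norm_of_nonneg) auto
        also have "\<dots> = exp (\<omega> * h) * Re (g x x)"
          by (simp add: g.norm_of_square[symmetric] power2_eq_square)
        finally show ?case
          using elim by (simp add: g.scaleR_left g.diff_left field_simps)
      qed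
    qed
  qed
qed

end

section \<open>Boundedness from rank-one perturbed forms\<close>

text \<open>Isolates the Hilbert space argument: the form in \<open>bound\<close> is the perturbed
  scalar product of \<open>A x\<close> and \<open>x\<close>. Its second summand is a product, so
  fixing the factor \<open>cinner u x\<close> makes the bound control the functional
  \<open>cinner (A x) u\<close>.\<close>

lemma bounded_if_rank_one_forms_bounded_above:
  fixes A :: "'a::complex_hilbert_space \<Rightarrow> 'a"
  assumes add: "\<And>x y. x \<in> D \<Longrightarrow> y \<in> D \<Longrightarrow> x + y \<in> D \<and> A (x + y) = A x + A y"
    and scaleC: "\<And>c x. x \<in> D \<Longrightarrow> c *\<^sub>C x \<in> D \<and> A (c *\<^sub>C x) = c *\<^sub>C A x"
    and dense: "closure D = UNIV"
    and bound: "\<And>u. \<exists>K. \<forall>x\<in>D. Re (cinner (A x) x + cinner (A x) u * cinner u x) \<le> K * (norm x)\<^sup>2"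
  obtains C where "\<And>x. x \<in> D \<Longrightarrow> norm (A x) \<le> C * norm x"
proof -
  obtain K where K: "\<And>x. x \<in> D \<Longrightarrow> Re (cinner (A x) x) \<le> K * (norm x)\<^sup>2"
    using bound[of 0] by auto
  \<comment> \<open>The term with \<open>\<bar>K\<bar>\<close> absorbs the upper bound of the form;
    the summand 1 leaves the squared norm over.\<close>
  define p where "p x = (\<bar>K\<bar> + 1) * (norm x)\<^sup>2 - Re (cinner (A x) x)" for x
  have p_ge: "(norm x)\<^sup>2 \<le> p x" if "x \<in> D" for x
  proof -
    have "Re (cinner (A x) x) \<le> \<bar>K\<bar> * (norm x)\<^sup>2"
      using K[OF that] by (rule order_trans) (simp add: mult_right_mono)
    then show ?thesis by (simp add: p_def algebra_simps)
  qed
  have p_scaleC: "p (c *\<^sub>C x) = (norm c)\<^sup>2 * p x" if "x \<in> D" for c x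
  proof -
    have "cinner (A (c *\<^sub>C x)) (c *\<^sub>C x) = of_real ((norm c)\<^sup>2) * cinner (A x) x"
      using that by (simp only: scaleC cinner.scaleC_left cinner.scaleC_right complex_norm_square mult_ac)
    then show ?thesis
      by (simp only: p_def norm_scaleC Re_complex_of_real times_complex.sel Im_complex_of_real)
         (simp add: algebra_simps power_mult_distrib)
  qed
  \<comment> \<open>The parallelogram identity for the quadratic form \<open>p\<close>, with the
    nonnegative \<open>p (x - y)\<close> dropped.\<close>
  have p_add: "p (x + y) \<le> 2 * p x + 2 * p y" if "x \<in> D" "y \<in> D" for x y
  proof -
    have y: "- y \<in> D" "A (- y) = - A y"
      using scaleC[OF that(2), of "-1"] by (simp_all add: scaleC_minus_one)
    then have xy: "x - y \<in> D" "A (x - y) = A x - A y" using add[OF that(1) y(1)] by auto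
    have "p (x + y) + p (x - y) = 2 * p x + 2 * p y"
      unfolding p_def Re_cinner_self[symmetric] xy(2) conjunct2[OF add[OF that]]
      by (simp add: cinner.add_left cinner.add_right cinner.diff_left cinner.diff_right algebra_simps)
    moreover have "0 \<le> p (x - y)" using p_ge[OF xy(1)] by (meson order_trans zero_le_power2)
    ultimately show ?thesis by simp
  qed
  have pointwise: "\<exists>C. \<forall>y\<in>{y\<in>D. p y \<le> 1}. norm (cinner u (A y)) \<le> C" for u
  proof (cases "u = 0")
    case False
    \<comment> \<open>A vector of \<open>D\<close> closer to \<open>u\<close> than 0 is cannot be
      orthogonal to \<open>u\<close>.\<close>
    obtain x1 where x1: "x1 \<in> D" "norm (u - x1) < norm u"
      using dense False closure_approachable[of u D]
      by (metis UNIV_I dist_commute dist_norm zero_less_norm_iff)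
    have "cinner u x1 \<noteq> 0"
    proof
      assume "cinner u x1 = 0"
      then have "(norm u)\<^sup>2 = Re (cinner u (u - x1))"
        by (simp add: cinner.diff_right Re_cinner_self)
      also have "\<dots> \<le> norm u * norm (u - x1)"
        using norm_cinner_le complex_Re_le_cmod order_trans by blast
      also have "\<dots> < (norm u)\<^sup>2"
        using x1 False by (simp add: power2_eq_square)
      finally show False by simp
    qed
    \<comment> \<open>The conjugate compensates for conjugate linearity in the second
      argument.\<close>
    define x0 where "x0 = cnj (1 / cinner u x1) *\<^sub>C x1"
    have x0: "x0 \<in> D" "cinner u x0 = 1"
      using x1 scaleC \<open>cinner u x1 \<noteq> 0\<close> by (auto simp: x0_def cinner.scaleC_right)
    obtain K' where K': "\<And>x. x \<in> D \<Longrightarrow>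
        Re (cinner (A x) x + cinner (A x) u * cinner u x) \<le> K' * (norm x)\<^sup>2"
      using bound[of u] by blast
    \<comment> \<open>The unperturbed form \<open>Re (cinner (A x) x)\<close> has no lower bound in
      terms of the norm alone, so it is moved to the right, where \<open>p x\<close> contains
      it.\<close>
    have L: "Re (cinner (A x) u * cinner u x) \<le> (\<bar>K'\<bar> + 1) * p x" if "x \<in> D" for x
    proof -
      have "Re (cinner (A x) u * cinner u x) \<le> K' * (norm x)\<^sup>2 + p x - (\<bar>K\<bar> + 1) * (norm x)\<^sup>2"
        using K'[OF that] by (simp add: p_def)
      also have "\<dots> \<le> \<bar>K'\<bar> * (norm x)\<^sup>2 + p x"
        by (intro diff_le_eq[THEN iffD2] add_increasing2 add_right_mono mult_right_mono) auto
      also have "\<dots> \<le> \<bar>K'\<bar> * p x + p x"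
        by (intro add_right_mono mult_left_mono p_ge that) simp
      finally show ?thesis by (simp add: algebra_simps)
    qed
    \<comment> \<open>For the vector \<open>x = l x0 + y\<close> below, where
      \<open>norm l \<le> 1 + norm u\<close> and \<open>p y \<le> 1\<close>, the first summand
      dominates the bound \<open>L\<close> and the second the contribution of \<open>l\<close> times
      \<open>A x0\<close>.\<close>
    define M where "M = (\<bar>K'\<bar> + 1) * (2 * ((1 + norm u)\<^sup>2 * p x0) + 2)
      + (1 + norm u) * norm (cinner (A x0) u)"
    have "norm (cinner u (A y)) \<le> M" if y: "y \<in> D" "p y \<le> 1" for y
    proof -
      define a where "a = cinner (A y) u"
      define b where "b = cinner u y"
      \<comment> \<open>The phase \<open>w\<close> makes \<open>a w\<close> real and nonnegative.
        Once \<open>cinner u x = w\<close>, the part of the perturbation term that comes from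
        \<open>A y\<close> is exactly \<open>norm a\<close>.\<close>
      obtain w where w: "norm w = 1" "a * w = of_real (norm a)"
      proof (cases "a = 0")
        case True
        then show ?thesis using that[of 1] by simp
      next
        case False
        have "a * (cnj a / of_real (norm a)) = of_real (norm a)"
          using False complex_norm_square[of a] by (simp add: field_simps power2_eq_square)
        then show ?thesis using that[of "cnj a / of_real (norm a)"] False by (simp add: norm_divide)
      qed
      \<comment> \<open>chosen such that \<open>(u, l x0 + y) = w\<close>\<close>
      define l where "l = cnj (w - b)"
      define x where "x = l *\<^sub>C x0 + y"
      have x: "x \<in> D" "A x = l *\<^sub>C A x0 + A y"
        using add scaleC x0(1) y(1) by (auto simp: x_def)
      have "cinner u x = w"
        unfolding x_def l_def cinner.add_right cinner.scaleC_right x0(2) b_def by simp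
      have "norm y \<le> 1"
        using p_ge[OF y(1)] y(2) by (simp add: power2_le_imp_le[of "norm y" 1])
      then have "norm b \<le> norm u"
        unfolding b_def using norm_cinner_le[of u y] mult_left_mono[of "norm y" 1 "norm u"] by simp
      then have l: "norm l \<le> 1 + norm u"
        unfolding l_def complex_mod_cnj using norm_triangle_ineq4[of w b] w(1) by simp
      have "Re (l * cinner (A x0) u * w) + norm a = Re (cinner (A x) u * cinner u x)"
        unfolding \<open>cinner u x = w\<close> x(2)
        by (simp only: cinner.add_left cinner.scaleC_left a_def[symmetric] distrib_right w(2) plus_complex.sel
            Re_complex_of_real)
      also have "\<dots> \<le> (\<bar>K'\<bar> + 1) * p x" by (rule L[OF x(1)])
      also have "\<dots> \<le> (\<bar>K'\<bar> + 1) * (2 * ((1 + norm u)\<^sup>2 * p x0) + 2)"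
      proof (rule mult_left_mono)
        have "p x \<le> 2 * p (l *\<^sub>C x0) + 2 * p y"
          unfolding x_def using x0(1) y(1) scaleC by (intro p_add) auto
        also have "\<dots> \<le> 2 * ((norm l)\<^sup>2 * p x0) + 2"
          using y(2) by (simp add: p_scaleC x0(1))
        also have "\<dots> \<le> 2 * ((1 + norm u)\<^sup>2 * p x0) + 2"
          using p_ge[OF x0(1)] l
          by (intro add_right_mono mult_left_mono mult_right_mono power_mono)
             (auto intro: order_trans[OF zero_le_power2])
        finally show "p x \<le> 2 * ((1 + norm u)\<^sup>2 * p x0) + 2" .
      qed simp
      finally have "norm a \<le> (\<bar>K'\<bar> + 1) * (2 * ((1 + norm u)\<^sup>2 * p x0) + 2) - Re (l * cinner (A x0) u * w)"
        by simp
      moreover have "- Re (l * cinner (A x0) u * w) \<le> (1 + norm u) * norm (cinner (A x0) u)"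
      proof -
        have "- Re (l * cinner (A x0) u * w) \<le> norm (l * cinner (A x0) u * w)"
          using abs_Re_le_cmod[of "l * cinner (A x0) u * w"] by linarith
        also have "\<dots> \<le> (1 + norm u) * norm (cinner (A x0) u)"
          by (simp add: norm_mult w(1) l mult_right_mono)
        finally show ?thesis .
      qed
      ultimately have "norm a \<le> M" by (simp add: M_def)
      then show ?thesis using cinner.commute[of u "A y"] by (simp add: a_def)
    qed
    then show ?thesis by blast
  qed auto
  obtain C where C: "0 \<le> C"
    and C': "\<And>y u. y \<in> D \<Longrightarrow> p y \<le> 1 \<Longrightarrow> norm (cinner u (A y)) \<le> C * norm u"
    by (rule uniform_boundedness[of "{y\<in>D. p y \<le> 1}" "\<lambda>y u. cinner u (A y)"])
       (use pointwise bounded_cinner.bounded_linear_left in auto)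
  \<comment> \<open>The functional bound is tested at \<open>u = A y\<close>.\<close>
  have unit: "norm (A y) \<le> C" if "y \<in> D" "p y \<le> 1" for y
  proof -
    have "(norm (A y))\<^sup>2 \<le> C * norm (A y)"
      using C'[OF that, of "A y"] complex_Re_le_cmod[of "cinner (A y) (A y)"]
      by (simp add: Re_cinner_self)
    then show ?thesis using C by (cases "norm (A y) = 0") (auto simp: power2_eq_square)
  qed
  show ?thesis
  proof (rule that)
    fix x assume x: "x \<in> D"
    show "norm (A x) \<le> (1 + C\<^sup>2 * (\<bar>K\<bar> + 2)) * norm x"
    \<comment> \<open>In the second case \<open>norm x \<le> norm (A x)\<close> also bounds the
      squared norm in \<open>p x\<close> by a multiple of \<open>norm x\<close> times
      \<open>norm (A x)\<close>, so one factor \<open>norm (A x)\<close> cancels.\<close>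
    proof (cases "norm (A x) \<le> norm x")
      case True
      also have "norm x \<le> (1 + C\<^sup>2 * (\<bar>K\<bar> + 2)) * norm x"
        by (simp add: distrib_right)
      finally show ?thesis .
    next
      case False
      have "x \<noteq> 0" using False scaleC[OF x, of 0] by auto
      then have "0 < (norm x)\<^sup>2" by simp
      then have p: "p x > 0" using p_ge[OF x] by linarith
      \<comment> \<open>As \<open>p\<close> is quadratic, this factor normalises \<open>p\<close> to
        1.\<close>
      define s where "s = complex_of_real (1 / sqrt (p x))"
      have s: "norm s = 1 / sqrt (p x)" using p by (simp add: s_def norm_divide)
      then have "p (s *\<^sub>C x) = 1" using p by (simp add: p_scaleC[OF x] power_divide)
      then have "norm (A (s *\<^sub>C x)) \<le> C" using scaleC[OF x] by (intro unit) auto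
      then have "norm (A x) \<le> C * sqrt (p x)"
        using p scaleC[OF x] by (simp add: norm_scaleC s field_simps)
      then have "(norm (A x))\<^sup>2 \<le> (C * sqrt (p x))\<^sup>2" by (intro power_mono) auto
      then have "(norm (A x))\<^sup>2 \<le> C\<^sup>2 * p x" using p by (simp add: power_mult_distrib)
      also have "\<dots> \<le> C\<^sup>2 * ((\<bar>K\<bar> + 2) * (norm x * norm (A x)))"
      proof (rule mult_left_mono)
        have "- Re (cinner (A x) x) \<le> norm x * norm (A x)"
          using abs_Re_le_cmod[of "cinner (A x) x"] norm_cinner_le[of "A x" x]
          by (simp add: mult.commute)
        moreover have "(\<bar>K\<bar> + 1) * (norm x)\<^sup>2 \<le> (\<bar>K\<bar> + 1) * (norm x * norm (A x))"
          using False by (intro mult_left_mono) (auto simp: power2_eq_square intro: mult_left_mono)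
        ultimately show "p x \<le> (\<bar>K\<bar> + 2) * (norm x * norm (A x))"
          by (simp add: p_def algebra_simps)
      qed simp
      finally have "norm (A x) * norm (A x) \<le> (C\<^sup>2 * (\<bar>K\<bar> + 2) * norm x) * norm (A x)"
        by (simp add: power2_eq_square mult_ac)
      moreover have "norm (A x) > 0" using False norm_ge_zero[of x] by linarith
      ultimately have "norm (A x) \<le> C\<^sup>2 * (\<bar>K\<bar> + 2) * norm x" by (simp add: mult_le_cancel_right)
      then show ?thesis unfolding distrib_right using norm_ge_zero[of x] by linarith
    qed
  qed
qed

text \<open>On the diagonal the perturbation adds the square of \<open>norm (cinner x u)\<close>,
  which is nonnegative and controlled by Cauchy-Schwarz.\<close>

lemma rank_one_perturbation:
  fixes u :: "'a::complex_hilbert_space"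
  defines "g \<equiv> \<lambda>x y. cinner x y + cinner x u * cinner u y"
  shows "equivalent_scalar_product g"
    and "Re (g x x) \<le> (1 + (norm u)\<^sup>2) * (norm x)\<^sup>2"
proof -
  have Re_g: "Re (g x x) = (norm x)\<^sup>2 + (norm (cinner x u))\<^sup>2" for x
    unfolding g_def cinner.commute[of u x]
    by (simp add: Re_cinner_self cmod_power2) (simp add: power2_eq_square)
  show upper: "Re (g x x) \<le> (1 + (norm u)\<^sup>2) * (norm x)\<^sup>2" for x
  proof -
    have "(norm (cinner x u))\<^sup>2 \<le> (norm x * norm u)\<^sup>2"
      by (intro power_mono norm_cinner_le) simp
    then show ?thesis by (simp add: Re_g algebra_simps power_mult_distrib)
  qed
  have "scalar_product g"
  proof
    fix x assume "x \<noteq> (0::'a)"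
    then have "0 < (norm x)\<^sup>2" by simp
    then show "0 < Re (g x x)" unfolding Re_g by (rule add_pos_nonneg) simp
  next
    fix x y show "g y x = cnj (g x y)"
      unfolding g_def complex_cnj_add complex_cnj_mult cinner.commute[of x y]
        cinner.commute[of u y] cinner.commute[of x u] by simp
  qed (simp_all add: g_def cinner.add_left cinner.scaleC_left algebra_simps)
  moreover have "norm x \<le> norm_of g x" for x
    unfolding norm_of_def Re_g by (rule real_le_rsqrt) simp
  moreover have "norm_of g x \<le> sqrt (1 + (norm u)\<^sup>2) * norm x" for x
  proof -
    have "norm_of g x \<le> sqrt ((1 + (norm u)\<^sup>2) * (norm x)\<^sup>2)"
      unfolding norm_of_def using upper by simp
    then show ?thesis by (simp add: real_sqrt_mult)
  qed
  moreover have "sqrt (1 + (norm u)\<^sup>2) > 0" by (simp add: add_pos_nonneg)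
  ultimately show "equivalent_scalar_product g"
    unfolding equivalent_scalar_product_def by (metis mult_1 zero_less_one)
qed

theorem theorem2:
  fixes T :: "real \<Rightarrow> 'a::complex_hilbert_space \<Rightarrow> 'a"
    and D :: "'a set" and A :: "'a \<Rightarrow> 'a"
  assumes "C0_semigroup T" and "generator T D A"
  shows "(bounded_operator D A \<longleftrightarrow>
            (\<forall>g. equivalent_scalar_product g \<longrightarrow> quasi_contractive g T)) \<and>
         (bounded_operator D A \<longleftrightarrow>
            (\<forall>g. equivalent_scalar_product g \<longrightarrow>
              (\<exists>K\<^sub>0::real. \<forall>x\<in>D. g x x = 1 \<longrightarrow> Re (g (A x) x) \<le> K\<^sub>0)))"
proof -
  interpret C0_semigroup T by (rule assms(1))
  note gen = assms(2)
  let ?Q = "\<lambda>g. \<exists>K\<^sub>0::real. \<forall>x\<in>D. g x x = 1 \<longrightarrow> Re (g (A x) x) \<le> K\<^sub>0"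
  have quasi_dissipative: "?Q g" if g: "equivalent_scalar_product g" and "quasi_contractive g T"
    for g :: "'a \<Rightarrow> 'a \<Rightarrow> complex"
  proof -
    obtain \<omega> where \<omega>: "\<And>x. x \<in> D \<Longrightarrow> Re (g (A x) x) \<le> \<omega> * Re (g x x)"
      using quasi_contractive_imp_quasi_dissipative[OF gen g \<open>quasi_contractive g T\<close>] by blast
    have "Re (g (A x) x) \<le> \<omega>" if "x \<in> D" "g x x = 1" for x
      using \<omega>[OF that(1)] that(2) by simp
    then show ?thesis by blast
  qed
  have bounded: "bounded_operator D A" if Q: "\<And>g. equivalent_scalar_product g \<Longrightarrow> ?Q g"
  proof -
    have rank_one: "\<exists>K. \<forall>x\<in>D. Re (cinner (A x) x + cinner (A x) u * cinner u x) \<le> K * (norm x)\<^sup>2"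
      for u :: 'a
    proof -
      define g where "g x y = cinner x y + cinner x u * cinner u y" for x y
      have g: "equivalent_scalar_product g" "\<And>x. Re (g x x) \<le> (1 + (norm u)\<^sup>2) * (norm x)\<^sup>2"
        unfolding g_def[abs_def] by (rule rank_one_perturbation)+
      interpret g: scalar_product g using equivalent_scalar_productE[OF g(1)] by metis
      obtain K where K: "\<And>x. x \<in> D \<Longrightarrow> g x x = 1 \<Longrightarrow> Re (g (A x) x) \<le> K"
        using Q[OF g(1)] by blast
      \<comment> \<open>Normalising \<open>x\<close> in the \<open>g\<close>-norm makes the bound on
        unit vectors homogeneous; \<open>\<bar>K\<bar>\<close> allows \<open>g x x\<close> to be
        replaced by its upper bound even for negative \<open>K\<close>.\<close>
      have "Re (g (A x) x) \<le> \<bar>K\<bar> * (1 + (norm u)\<^sup>2) * (norm x)\<^sup>2" if x: "x \<in> D" for x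
      proof (cases "x = 0")
        case False
        define r where "r = Re (g x x)"
        have r: "r > 0" "g x x = of_real r"
          using g.pos_def[OF False] g.self_real[of x] by (auto simp: r_def)
        let ?y = "(1 / sqrt r) *\<^sub>R x"
        have "g ?y ?y = 1"
          using r by (simp add: g.scaleR_left g.scaleR_right scaleR_conv_of_real flip: of_real_mult)
        then have "Re (g (A ?y) ?y) \<le> K" using K generator_scaleR[OF gen x] by blast
        then have "Re (g (A x) x) \<le> K * r"
          using r generator_scaleR(2)[OF gen x] by (simp add: g.scaleR_left g.scaleR_right field_simps)
        also have "\<dots> \<le> \<bar>K\<bar> * r" using r by (intro mult_right_mono) auto
        also have "\<dots> \<le> \<bar>K\<bar> * ((1 + (norm u)\<^sup>2) * (norm x)\<^sup>2)"
          unfolding r_def by (intro mult_left_mono g) simp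
        finally show ?thesis by (simp add: mult.assoc)
      qed simp
      then show ?thesis unfolding g_def by (intro exI ballI)
    qed
    show ?thesis
    proof (rule bounded_if_rank_one_forms_bounded_above[OF _ _ generator_dense[OF gen] rank_one])
      fix C assume "\<And>x. x \<in> D \<Longrightarrow> norm (A x) \<le> C * norm x"
      then show ?thesis by (rule generator_bounded_imp_bounded_operator[OF gen])
    qed (simp_all add: generator_add[OF gen] generator_scaleC[OF gen])
  qed
  note contractive = bounded_operator_imp_quasi_contractive[OF gen]
  show ?thesis
  \<comment> \<open>The implications form a cycle: (ii) reaches (i) through (iii), and (i) reaches
    (iii) through (ii).\<close>
  proof (intro conjI iffI allI impI)
    assume "\<forall>g. equivalent_scalar_product g \<longrightarrow> quasi_contractive g T"
    then have "?Q g" if "equivalent_scalar_product g" for g :: "'a \<Rightarrow> 'a \<Rightarrow> complex"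
      using that quasi_dissipative[of g] by simp
    then show "bounded_operator D A" by (rule bounded)
  next
    assume "\<forall>g. equivalent_scalar_product g \<longrightarrow> ?Q g"
    then have "?Q g" if "equivalent_scalar_product g" for g :: "'a \<Rightarrow> 'a \<Rightarrow> complex"
      using that by simp
    then show "bounded_operator D A" by (rule bounded)
  next
    fix g :: "'a \<Rightarrow> 'a \<Rightarrow> complex"
    assume "bounded_operator D A" "equivalent_scalar_product g"
    then show "?Q g" using quasi_dissipative[of g] contractive[of g] by simp
  qed (rule contractive)
qed

end
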